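(* Let $X$ be any space and $\kappa$ an infinite cardinal. If $X^\kappa$ contains a closed discrete set of size $d(X^\kappa)$, then $X^\kappa$ is $e$-separable.
   Context: All topological spaces are assumed to be $T_1$. A space $Z$ is $e$-separable if there is a sequence $(D_n)_{n\in\omega}$ of closed discrete subspaces of $Z$ such that $\bigcup_{n\in\omega}D_n$ is dense in $Z$. The density $d(Z)$ is the smallest cardinality of a dense subset of $Z$. $X^\kappa$ carries the Tychonoff product topology. *)

theory Defs
  imports "HOL-Analysis.Analysis"
begin

unbundle cardinal_syntax

definition dense_in :: "'a topology \<Rightarrow> 'a set \<Rightarrow> bool" where
  "dense_in Z D \<longleftrightarrow> D \<subseteq> topspace Z \<and> Z closure_of D = topspace Z"

definition closed_discrete_in :: "'a topology \<Rightarrow> 'a set \<Rightarrow> bool" where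
  "closed_discrete_in Z D \<longleftrightarrow> closedin Z D \<and> subtopology Z D = discrete_topology D"

definition e_separable :: "'a topology \<Rightarrow> bool" where
  "e_separable Z \<longleftrightarrow>
     (\<exists>D :: nat \<Rightarrow> 'a set. (\<forall>n. closed_discrete_in Z (D n)) \<and> dense_in Z (\<Union>n. D n))"

(* Cardinals are represented as in the library by cardinal orders and are unique only up to =o.
   The value below is the cardinality of an arbitrarily chosen dense set of least size; by
   top_density_attained and top_density_least it is the least cardinality of a dense set.
   No infinite lower bound is built in. *)
definition top_density :: "'a topology \<Rightarrow> 'a rel" where
  "top_density Z = |SOME D. dense_in Z D \<and> (\<forall>E. dense_in Z E \<longrightarrow> |D| \<le>o |E| )|"

lemma top_density_witness:
  "\<exists>D. dense_in Z D \<and> top_density Z = |D| \<and> (\<forall>E. dense_in Z E \<longrightarrow> |D| \<le>o |E| )"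
proof -
  have "dense_in Z (topspace Z)"
    by (simp add: dense_in_def)
  then have "card_of ` Collect (dense_in Z) \<noteq> {}"
    by blast
  moreover have "\<forall>r \<in> card_of ` Collect (dense_in Z). Card_order r"
    by (auto simp: card_of_Card_order)
  ultimately have "\<exists>D. dense_in Z D \<and> (\<forall>E. dense_in Z E \<longrightarrow> |D| \<le>o |E| )"
    using exists_minim_Card_order[of "card_of ` Collect (dense_in Z)"] by auto
  from someI_ex[OF this] show ?thesis
    unfolding top_density_def by blast
qed

lemma top_density_attained: "\<exists>D. dense_in Z D \<and> top_density Z = |D|"
  using top_density_witness by blast

lemma top_density_least: "dense_in Z E \<Longrightarrow> top_density Z \<le>o |E|"
  using top_density_witness[of Z] by auto

end

theory Submission
  imports Defs
begin

text \<open>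
  Since \<open>\<kappa> \<times> \<omega>\<close> has size \<open>\<kappa>\<close>, the power \<open>Y = X\<^sup>\<kappa>\<close> is homeomorphic to \<open>Y\<^sup>\<omega>\<close>. Let \<open>D\<close> be dense
  in \<open>Y\<close> and \<open>S\<close> closed discrete of the same infinite size. Extend each \<open>t \<in> D\<^sup>n\<close> to a point of
  \<open>Y\<^sup>\<omega>\<close> by repeating a code \<open>c t \<in> S\<close>, with \<open>c\<close> injective on \<open>D\<^sup>n\<close>. The resulting set \<open>E n\<close> is
  closed discrete because the \<open>n\<close>-th projection maps it injectively into \<open>S\<close>, and the union of the
  \<open>E n\<close> is dense because a basic open set restricts finitely many coordinates.
  A finite dense set is itself closed discrete.
\<close>

text \<open>Closedness puts every accumulation point inside \<open>D\<close>; discreteness leaves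
  none there.\<close>

lemma closed_discrete_in_iff_derived_set:
  "closed_discrete_in Z D \<longleftrightarrow> D \<subseteq> topspace Z \<and> Z derived_set_of D = {}"
  unfolding closed_discrete_in_def closedin_contains_derived_set subtopology_eq_discrete_topology_eq
  by blast

lemma closed_discrete_in_finite:
  assumes "t1_space Z" "finite D" "D \<subseteq> topspace Z"
  shows "closed_discrete_in Z D"
  using assms by (simp add: closed_discrete_in_iff_derived_set t1_space_derived_set_of_finite)

text \<open>In a T1 space every neighbourhood of an accumulation point of \<open>E\<close> meets
  \<open>E\<close> infinitely often. Pulling back a neighbourhood of \<open>f x\<close> that
  contains no point of \<open>S\<close> other than possibly \<open>f x\<close> leaves points of
  \<open>E\<close> all sent to \<open>f x\<close>, so at most one by injectivity.\<close>

lemma closed_discrete_in_inj_continuous_map: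
  assumes Y: "t1_space Y"
    and f: "continuous_map Y Z f" "inj_on f E" "f ` E \<subseteq> S"
    and E: "E \<subseteq> topspace Y"
    and S: "closed_discrete_in Z S"
  shows "closed_discrete_in Y E"
proof -
  have "x \<notin> Y derived_set_of E" for x
  proof
    assume x: "x \<in> Y derived_set_of E"
    then have xY: "x \<in> topspace Y"
      by (simp add: in_derived_set_of)
    then have "f x \<in> topspace Z"
      using f(1) by (auto simp: continuous_map_def)
    moreover have "f x \<notin> Z derived_set_of S"
      using S by (simp add: closed_discrete_in_iff_derived_set)
    ultimately obtain V where V: "openin Z V" "f x \<in> V" "V \<inter> S \<subseteq> {f x}"
      unfolding in_derived_set_of by blast
    define U where "U = {y \<in> topspace Y. f y \<in> V}"
    have "openin Y U"
      unfolding U_def using f(1) V(1) by (rule openin_continuous_map_preimage)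
    moreover have "x \<in> U"
      using xY V by (simp add: U_def)
    ultimately have "infinite (E \<inter> U)"
      using x iffD1[OF t1_space_derived_set_of_infinite_openin Y] by simp
    moreover have "f ` (E \<inter> U) \<subseteq> {f x}"
      using V f(3) by (auto simp: U_def)
    then have "finite (f ` (E \<inter> U))"
      by (rule finite_subset) simp
    then have "finite (E \<inter> U)"
      by (rule finite_imageD) (use f(2) in \<open>auto intro: inj_on_subset\<close>)
    ultimately show False
      by simp
  qed
  then show ?thesis
    using E by (auto simp: closed_discrete_in_iff_derived_set)
qed

text \<open>An infinite set absorbs products with sets no larger than itself. The bound leaves room
  in \<open>S\<close> for a separate code for each list of a given length.\<close>

lemma card_of_lists_length_infinite:
  assumes "infinite D"
  shows "|{t. set t \<subseteq> D \<and> length t = n}| \<le>o |D|"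
proof (induction n)
  case 0
  have "{t. set t \<subseteq> D \<and> length t = 0} = {[]}"
    by auto
  then show ?case
    using assms by (simp only:) (rule card_of_singl_ordLeq, auto)
next
  case (Suc n)
  let ?L = "{t. set t \<subseteq> D \<and> length t = n}"
  have "{t. set t \<subseteq> D \<and> length t = Suc n} = (\<lambda>(x, t). x # t) ` (D \<times> ?L)"
    by (force simp: length_Suc_conv)
  then have "|{t. set t \<subseteq> D \<and> length t = Suc n}| \<le>o |D \<times> ?L|"
    by (simp only: card_of_image)
  also have "|D \<times> ?L| \<le>o |D|"
    using card_of_Sigma_ordLeq_infinite[OF assms, of D "\<lambda>_. ?L"] Suc card_of_refl ordIso_imp_ordLeq by blast
  finally show ?case .
qed

lemma dense_in_intersects_openin:
  "dense_in Z D \<longleftrightarrow> D \<subseteq> topspace Z \<and> (\<forall>U. openin Z U \<and> U \<noteq> {} \<longrightarrow> D \<inter> U \<noteq> {})"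
  unfolding dense_in_def dense_intersects_open by blast

theorem theorem3p5:
  fixes X :: "'a topology" and \<kappa> :: "'k rel"
  assumes "t1_space X"
    and "Cinfinite \<kappa>"
    and "\<exists>S. closed_discrete_in (product_topology (\<lambda>_. X) (Field \<kappa>)) S \<and>
             |S| =o top_density (product_topology (\<lambda>_. X) (Field \<kappa>))"
  shows "e_separable (product_topology (\<lambda>_. X) (Field \<kappa>))"
proof -
  define K where "K = Field \<kappa>"
  define Y where "Y = product_topology (\<lambda>_. X) K"
  have Y: "t1_space Y"
    using assms(1) by (auto simp: Y_def t1_space_product_topology)
  obtain S where S: "closed_discrete_in Y S" "|S| =o top_density Y"
    using assms(3) by (auto simp: Y_def K_def)
  obtain D where D: "dense_in Y D" "top_density Y = |D|"
    using top_density_attained by blast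
  have "e_separable Y"
  proof (cases "finite D")
    case True
    then have "closed_discrete_in Y D"
      using Y D(1) by (auto simp: dense_in_def intro: closed_discrete_in_finite)
    then show ?thesis
      unfolding e_separable_def using D(1) by (intro exI[of _ "\<lambda>_. D"]) auto
  next
    case False
    have DY: "D \<subseteq> topspace Y" and SY: "S \<subseteq> topspace Y"
      using D(1) S(1) by (auto simp: dense_in_def closed_discrete_in_iff_derived_set)
    have "infinite K"
      using assms(2) by (simp add: K_def cinfinite_def)
    then have "|K \<times> (UNIV::nat set)| =o |K|"
      using card_of_Times_infinite[of K "UNIV::nat set"] infinite_iff_card_of_nat by auto
    then obtain h where h: "bij_betw h (K \<times> (UNIV::nat set)) K"
      using card_of_ordIso by blast
    \<comment> \<open>\<open>p\<close> reads a coordinate of \<open>Y\<close> as a pair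
      \<open>(k, m)\<close>: place \<open>k\<close> in block \<open>m\<close>. Each block is indexed
      by \<open>K\<close>, hence is again a point of \<open>Y\<close>.\<close>
    define p where "p = inv_into (K \<times> (UNIV::nat set)) h"
    have hK: "h (k, m) \<in> K" if "k \<in> K" for k m
      using h that by (auto simp: bij_betw_def)
    have ph: "p (h (k, m)) = (k, m)" if "k \<in> K" for k m
      unfolding p_def using h that by (simp add: bij_betw_def)
    have hp: "h (p i) = i" "fst (p i) \<in> K" if "i \<in> K" for i
    proof -
      show "h (p i) = i"
        unfolding p_def using h that by (simp add: bij_betw_inv_into_right)
      have "p i \<in> K \<times> UNIV"
        unfolding p_def using h that by (metis bij_betw_def inv_into_into)
      then show "fst (p i) \<in> K"
        by auto
    qed
    define L where "L n = {t. set t \<subseteq> D \<and> length t = n}" for n :: nat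
    have "\<exists>c. inj_on c (L n) \<and> c ` L n \<subseteq> S" for n
    proof -
      have "|L n| \<le>o |D|"
        unfolding L_def by (rule card_of_lists_length_infinite[OF False])
      also have "|D| =o |S|"
        using S(2) D(2) ordIso_symmetric by metis
      finally show ?thesis
        by (simp add: card_of_ordLeq)
    qed
    then obtain c where c: "\<And>n. inj_on (c n) (L n)" "\<And>n. c n ` L n \<subseteq> S"
      by metis
    have cY: "c n t \<in> topspace Y" if "t \<in> L n" for n t
      using c(2)[of n] SY that by blast
    \<comment> \<open>Block \<open>m < n\<close> holds \<open>t ! m\<close>; every block from
      \<open>n\<close> on holds the code \<open>c n t\<close>.\<close>
    define x where "x n t = (\<lambda>i\<in>K. if snd (p i) < n then (t ! snd (p i)) (fst (p i))
                                    else c n t (fst (p i)))" for n t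
    define E where "E n = x n ` L n" for n
    have xY: "x n t \<in> topspace Y" if "t \<in> L n" for n t
    proof -
      have "t ! m \<in> topspace Y" if "m < n" for m
        using \<open>t \<in> L n\<close> that DY nth_mem[of m t]
        unfolding L_def by blast
      then show ?thesis
        using cY[OF that] hp by (auto simp: Y_def x_def PiE_iff)
    qed
    have "closed_discrete_in Y (E n)" for n
    proof (rule closed_discrete_in_inj_continuous_map[OF Y _ _ _ _ S(1)])
      \<comment> \<open>\<open>q\<close> extracts block \<open>n\<close>, the first one that holds
        the code, so it recovers \<open>c n t\<close> and thereby \<open>t\<close>.\<close>
      define q where "q y = (\<lambda>k\<in>K. y (h (k, n)))" for y :: "'k \<Rightarrow> 'a"
      have qx: "q (x n t) = c n t" if "t \<in> L n" for t
        using cY[OF that] by (auto simp: q_def x_def ph hK Y_def PiE_iff extensional_def)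
      show "continuous_map Y Y q"
        unfolding Y_def continuous_map_componentwise q_def
        by (auto intro!: continuous_map_product_projection hK)
      show "inj_on q (E n)"
        using c(1)[of n] by (auto simp: E_def qx inj_on_def)
      show "q ` E n \<subseteq> S"
        using c(2)[of n] by (auto simp: E_def qx)
      show "E n \<subseteq> topspace Y"
        using xY by (auto simp: E_def)
    qed
    moreover have "dense_in Y (\<Union>n. E n)"
      unfolding dense_in_intersects_openin
    proof (intro conjI allI impI)
      show "(\<Union>n. E n) \<subseteq> topspace Y"
        using xY by (auto simp: E_def)
    next
      fix W assume "openin Y W \<and> W \<noteq> {}"
      then obtain z where W: "openin Y W" and z: "z \<in> W"
        by blast
      then obtain U where U: "finite {i \<in> K. U i \<noteq> topspace X}" "\<And>i. i \<in> K \<Longrightarrow> openin X (U i)"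
          "z \<in> PiE K U" "PiE K U \<subseteq> W"
        using bspec[OF W[unfolded Y_def openin_product_topology_alt] z] by auto
      \<comment> \<open>Only finitely many coordinates are restricted, so all of them lie in blocks
        below some \<open>n\<close>.\<close>
      obtain n where n: "\<And>i. i \<in> K \<Longrightarrow> U i \<noteq> topspace X \<Longrightarrow> snd (p i) < n"
      proof -
        have "finite ((\<lambda>i. snd (p i)) ` {i \<in> K. U i \<noteq> topspace X})"
          using U(1) by blast
        then obtain n where "\<forall>m \<in> (\<lambda>i. snd (p i)) ` {i \<in> K. U i \<noteq> topspace X}. m < n"
          using finite_nat_set_iff_bounded by metis
        then show ?thesis
          by (intro that) auto
      qed
      \<comment> \<open>The conditions of \<open>U\<close> on block \<open>m\<close> form a basic
        open box of \<open>Y\<close>: distinct \<open>k\<close> give distinct coordinates, so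
        finitely many are restricted. The box contains block \<open>m\<close> of \<open>z\<close>,
        hence a point of \<open>D\<close>.\<close>
      have "\<exists>d \<in> D. \<forall>k \<in> K. d k \<in> U (h (k, m))" for m
      proof -
        let ?B = "PiE K (\<lambda>k. U (h (k, m)))"
        have "inj_on (\<lambda>k. h (k, m)) K"
          by (rule inj_onI) (metis ph fst_conv)
        then have "finite ((\<lambda>k. h (k, m)) -` {i \<in> K. U i \<noteq> topspace X} \<inter> K)"
          using U(1) by (rule finite_vimage_IntI[rotated])
        then have "finite {k \<in> K. U (h (k, m)) \<noteq> topspace X}"
          by (rule rev_finite_subset) (auto simp: hK)
        then have "openin Y ?B"
          unfolding Y_def openin_PiE_gen using U(2) hK by auto
        moreover have "(\<lambda>k\<in>K. z (h (k, m))) \<in> ?B"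
          using U(3) hK by auto
        ultimately have "D \<inter> ?B \<noteq> {}"
          using D(1) unfolding dense_in_intersects_openin by blast
        then show ?thesis
          by blast
      qed
      then obtain d where d: "\<And>m. d m \<in> D" "\<And>m k. k \<in> K \<Longrightarrow> d m k \<in> U (h (k, m))"
        by metis
      define t where "t = map d [0..<n]"
      have t: "t \<in> L n"
        using d(1) by (auto simp: L_def t_def)
      have "x n t i \<in> U i" if "i \<in> K" for i
      proof (cases "snd (p i) < n")
        case True
        then show ?thesis
          using that d(2)[of "fst (p i)" "snd (p i)"] hp[OF that] by (simp add: x_def t_def)
      next
        case False
        \<comment> \<open>From block \<open>n\<close> on nothing is restricted, so the code there
          does no harm.\<close>
        then have "U i = topspace X"
          using n that by blast
        then show ?thesis
          using xY[OF t] that by (auto simp: Y_def)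
      qed
      then have "x n t \<in> PiE K U"
        by (auto simp: x_def PiE_iff)
      then have "x n t \<in> W"
        using U(4) by blast
      then show "(\<Union>n. E n) \<inter> W \<noteq> {}"
        using t by (auto simp: E_def)
    qed
    ultimately show ?thesis
      unfolding e_separable_def by blast
  qed
  then show ?thesis
    by (simp add: Y_def K_def)
qed

end
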